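(* Let $X$ be a stacked simplicial complex of dimension $d$ with vertex set $V$ and facet set $F$, and let $r\ge1$ and $s\ge1$ be integers. Then the maps $\Phi$ and $\Psi$ restrict to mutually inverse bijections between the set of partitions of $V$ into $r+d$ non-empty parts, each part being $(s+1)$-scattered, and the set of partitions of $F$ into $r$ non-empty parts, each part being $s$-scattered.
   Context: A simplicial complex $X$ on a finite vertex set $V$ is a family of subsets (faces) of $V$ closed under taking subsets, every element of $V$ lying in some face; facets are inclusion-maximal faces. $X$ is pure of dimension $d$ if every facet has $d+1$ elements; a codimension one face is a face with $d$ elements. $X$ is stacked if it is pure of some dimension $d$ and its facets can be ordered $F_0,\dots,F_k$ such that for each $p\ge1$, $F_p$ contains exactly one vertex $v_p$ not in $F_0\cup\dots\cup F_{p-1}$, and $F_p\setminus\{v_p\}\subseteq F_j$ for some $j<p$. A walk is a sequence of facets $f_1,\dots,f_p$ ($p\ge1$) with each $f_i\cap f_{i+1}$ of exactly $d$ elements; a path is a walk in which the faces $f_i\cap f_{i+1}$, $1\le i<p$, are pairwise distinct; in a stacked complex there is a unique path between any two facets. For faces $h,k$ with $h\cup k$ not contained in any codimension one face, a path between $h$ and $k$, written $h\,|\,f_1,\dots,f_p\,|\,k$, is a path with $h\subseteq f_1$, $k\subseteq f_p$ and, if $p\ge2$, $h\not\subseteq f_1\cap f_2$, $k\not\subseteq f_p\cap f_{p-1}$; in a stacked complex it exists and is unique. Distances: for facets $f,g$, $\mathrm{dist}(f,g)$ is the minimal $p-1$ over walks $f_1,\dots,f_p$ with $f_1=f$, $f_p=g$;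 for distinct vertices $v,w$, $\mathrm{dist}(v,w)$ is the minimal $p\ge1$ such that there is a walk $f_1,\dots,f_p$ with $v\in f_1$, $w\in f_p$. A set of vertices (resp. facets) is $s$-scattered if any two distinct elements have distance $\ge s$; an independent set of vertices is a $2$-scattered one. The map $\Phi$ (vertex partitions into independent sets $\to$ facet partitions): given such a partition $\mathcal V$ of $V$, for distinct facets $f,f'$ with unique path $f=f_1,\dots,f_p=f'$, let $v$ be the element of $f_1\setminus f_2$ and $w$ the element of $f_p\setminus f_{p-1}$; set $f\sim'_F f'$ iff $v,w$ lie in the same part $P$ of $\mathcal V$ and none of $f_2,\dots,f_{p-1}$ contains a vertex of $P$; $\Phi(\mathcal V)$ is the partition of $F$ into classes of the equivalence relation generated by $\sim'_F$. The map $\Psi$ (facet partitions $\to$ vertex partitions): given a partition $\mathcal F$ of $F$, for distinct vertices $v,w$ not lying in a common facet, with unique path $v\,|\,f_1,\dots,f_p\,|\,w$, set $v\sim'_V w$ iff $f_1,f_p$ lie in the same part $Q$ of $\mathcal F$ and none of $f_2,\dots,f_{p-1}$ lies in $Q$; $\Psi(\mathcal F)$ is the partition of $V$ into classes of the equivalence relation generated by $\sim'_V$. *)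

theory Defs
  imports Main "HOL-Library.Disjoint_Sets" "HOL-Library.Extended_Nat"
begin

(* A simplicial complex is given by its set of faces X; its vertex set is \<Union>X. *)
definition simplicial_complex :: "'a set set \<Rightarrow> bool" where
  "simplicial_complex X \<longleftrightarrow> finite (\<Union>X) \<and> (\<forall>f\<in>X. \<forall>g. g \<subseteq> f \<longrightarrow> g \<in> X)"

definition vertices :: "'a set set \<Rightarrow> 'a set" where
  "vertices X = \<Union>X"

definition facets :: "'a set set \<Rightarrow> 'a set set" where
  "facets X = {f \<in> X. \<forall>g\<in>X. f \<subseteq> g \<longrightarrow> g = f}"

definition pure :: "'a set set \<Rightarrow> nat \<Rightarrow> bool" where
  "pure X d \<longleftrightarrow> (\<forall>f\<in>facets X. card f = d + 1)"

definition stacked :: "'a set set \<Rightarrow> nat \<Rightarrow> bool" where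
  "stacked X d \<longleftrightarrow> simplicial_complex X \<and> pure X d \<and>
     (\<exists>fs. fs \<noteq> [] \<and> distinct fs \<and> set fs = facets X \<and>
        (\<forall>p. 1 \<le> p \<and> p < length fs \<longrightarrow>
           (\<exists>v. fs ! p - \<Union>(set (take p fs)) = {v} \<and>
                (\<exists>j<p. fs ! p - {v} \<subseteq> fs ! j))))"

(* walk: nonempty sequence of facets, consecutive ones meeting in d elements *)
definition walk :: "'a set set \<Rightarrow> nat \<Rightarrow> 'a set list \<Rightarrow> bool" where
  "walk X d fs \<longleftrightarrow> fs \<noteq> [] \<and> set fs \<subseteq> facets X \<and>
     (\<forall>i. Suc i < length fs \<longrightarrow> card (fs ! i \<inter> fs ! Suc i) = d)"

(* path: walk whose consecutive intersections f_i \<inter> f_{i+1} are pairwise distinct *)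
definition is_path :: "'a set set \<Rightarrow> nat \<Rightarrow> 'a set list \<Rightarrow> bool" where
  "is_path X d fs \<longleftrightarrow> walk X d fs \<and>
     distinct (map (\<lambda>i. fs ! i \<inter> fs ! Suc i) [0..<length fs - 1])"

definition facet_dist :: "'a set set \<Rightarrow> nat \<Rightarrow> 'a set \<Rightarrow> 'a set \<Rightarrow> enat" where
  "facet_dist X d f g =
     (INF fs \<in> {fs. walk X d fs \<and> hd fs = f \<and> last fs = g}. enat (length fs - 1))"

definition vertex_dist :: "'a set set \<Rightarrow> nat \<Rightarrow> 'a \<Rightarrow> 'a \<Rightarrow> enat" where
  "vertex_dist X d v w =
     (INF fs \<in> {fs. walk X d fs \<and> v \<in> hd fs \<and> w \<in> last fs}. enat (length fs))"

definition vertex_scattered :: "'a set set \<Rightarrow> nat \<Rightarrow> nat \<Rightarrow> 'a set \<Rightarrow> bool" where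
  "vertex_scattered X d s S \<longleftrightarrow>
     (\<forall>v\<in>S. \<forall>w\<in>S. v \<noteq> w \<longrightarrow> enat s \<le> vertex_dist X d v w)"

definition facet_scattered :: "'a set set \<Rightarrow> nat \<Rightarrow> nat \<Rightarrow> 'a set set \<Rightarrow> bool" where
  "facet_scattered X d s S \<longleftrightarrow>
     (\<forall>f\<in>S. \<forall>g\<in>S. f \<noteq> g \<longrightarrow> enat s \<le> facet_dist X d f g)"

(* the relation \<sim>'_F used to define \<Phi> *)
definition PhiRel :: "'a set set \<Rightarrow> nat \<Rightarrow> 'a set set \<Rightarrow> ('a set \<times> 'a set) set" where
  "PhiRel X d VV = {(f, f'). f \<in> facets X \<and> f' \<in> facets X \<and> f \<noteq> f' \<and>
     (\<exists>fs v w. is_path X d fs \<and> hd fs = f \<and> last fs = f' \<and> 2 \<le> length fs \<and>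
        fs ! 0 - fs ! 1 = {v} \<and> last fs - fs ! (length fs - 2) = {w} \<and>
        (\<exists>P\<in>VV. v \<in> P \<and> w \<in> P \<and> (\<forall>i. 1 \<le> i \<and> i < length fs - 1 \<longrightarrow> fs ! i \<inter> P = {})))}"

definition Phi :: "'a set set \<Rightarrow> nat \<Rightarrow> 'a set set \<Rightarrow> 'a set set set" where
  "Phi X d VV = facets X // ((PhiRel X d VV \<union> (PhiRel X d VV)\<inverse>)\<^sup>*)"

(* the relation \<sim>'_V used to define \<Psi> *)
definition PsiRel :: "'a set set \<Rightarrow> nat \<Rightarrow> 'a set set set \<Rightarrow> ('a \<times> 'a) set" where
  "PsiRel X d FF = {(v, w). v \<in> vertices X \<and> w \<in> vertices X \<and> v \<noteq> w \<and>
     \<not> (\<exists>f\<in>facets X. v \<in> f \<and> w \<in> f) \<and>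
     (\<exists>fs. is_path X d fs \<and> v \<in> hd fs \<and> w \<in> last fs \<and>
        (2 \<le> length fs \<longrightarrow> v \<notin> fs ! 0 \<inter> fs ! 1 \<and> w \<notin> last fs \<inter> fs ! (length fs - 2)) \<and>
        (\<exists>Q\<in>FF. hd fs \<in> Q \<and> last fs \<in> Q \<and> (\<forall>i. 1 \<le> i \<and> i < length fs - 1 \<longrightarrow> fs ! i \<notin> Q)))}"

definition Psi :: "'a set set \<Rightarrow> nat \<Rightarrow> 'a set set set \<Rightarrow> 'a set set" where
  "Psi X d FF = vertices X // ((PsiRel X d FF \<union> (PsiRel X d FF)\<inverse>)\<^sup>*)"

end

theory Submission
  imports Defs
begin

text \<open>
  View a partition of the vertices into \<open>r + d\<close> independent sets as a colouring \<open>c\<close> that is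
  injective on facets, and a partition of the facets into \<open>r\<close> parts as a labelling \<open>\<phi>\<close>.
  A codimension one face misses exactly \<open>r\<close> colours. The colouring and the labelling correspond when
  each codimension one face \<open>e\<close> carries a bijection \<open>\<beta> e\<close> from the colours it misses to the labels
  such that \<open>\<beta> e (c v) = \<phi> f\<close> whenever \<open>f = insert v e\<close> is a facet, and such that all \<open>\<beta> e\<close> with
  \<open>e \<subseteq> f\<close> agree on the colours missing in \<open>f\<close>.

  Along the stacking order, each new facet \<open>f\<close> brings one new vertex \<open>v\<close>, and \<open>\<beta>\<close> on \<open>f - {v}\<close>
  makes the choice of \<open>c v\<close> equivalent to the choice of \<open>\<phi> f\<close>. So every colouring extends to such a
  triple, and so does every labelling. Following a fixed colour along a path shows that the relations
  defining \<open>\<Phi>\<close> and \<open>\<Psi>\<close> express the same condition, once in terms of \<open>c\<close> and once in terms of \<open>\<phi>\<close>;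
  call such a path a link. Any walk between two elements of one part can be replaced by a chain of
  links, each no longer than the walk. Hence \<open>\<Phi>\<close> takes the fibres of \<open>c\<close> to those of \<open>\<phi>\<close>,
  \<open>\<Psi>\<close> takes them back, and the shortest links decide how scattered both partitions are.
\<close>

subsection \<open>Sets and partitions\<close>

lemma Diff_eq_singleton_of_card_Int:
  assumes "card f = Suc d" "card (f \<inter> g) = d"
  shows "\<exists>v. f - g = {v}"
proof -
  have "finite f" using assms(1) by (simp add: card_ge_0_finite)
  then have "card (f - g) = 1" using assms by (simp add: card_Diff_subset_Int)
  then show ?thesis by (simp add: card_1_singleton_iff)
qed

lemma Int_eq_of_card_Suc:
  assumes "card f = Suc d" "card g = Suc d" "f \<noteq> g" "e \<subseteq> f" "e \<subseteq> g" "card e = d"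
  shows "f \<inter> g = e"
proof -
  have fin: "finite f" "finite g" using assms(1,2) by (simp_all add: card_ge_0_finite)
  have "\<not> f \<subseteq> g" using assms(1-3) card_subset_eq[OF fin(2), of f] by auto
  then have "card (f \<inter> g) < card f" by (intro psubset_card_mono fin) auto
  then show ?thesis using assms fin card_seteq[of "f \<inter> g" e] by simp
qed

definition fibres :: "('b \<Rightarrow> 'c) \<Rightarrow> 'b set \<Rightarrow> 'b set set" where
  "fibres h S = (\<lambda>x. {y \<in> S. h y = h x}) ` S"

lemma partition_on_fibres: "partition_on S (fibres h S)"
  unfolding partition_on_def disjoint_def fibres_def by auto

lemma card_fibres: "card (fibres h S) = card (h ` S)"
proof -
  have "fibres h S = (\<lambda>k. {y \<in> S. h y = k}) ` h ` S"
    unfolding fibres_def by auto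
  moreover have "inj_on (\<lambda>k. {y \<in> S. h y = k}) (h ` S)"
    by (rule inj_onI) blast
  ultimately show ?thesis by (simp add: card_image)
qed

lemma bex_fibres_iff:
  "(\<exists>P\<in>fibres h S. x \<in> P \<and> y \<in> P \<and> T P) \<longleftrightarrow>
    x \<in> S \<and> y \<in> S \<and> h x = h y \<and> T {z \<in> S. h z = h x}"
  unfolding fibres_def by auto

lemma partition_on_eq_fibres:
  assumes "partition_on S PP"
  obtains h where "h ` S = PP" "fibres h S = PP"
proof -
  define E where "E = {(x, y). \<exists>P\<in>PP. x \<in> P \<and> y \<in> P}"
  define h where "h x = E `` {x}" for x
  have E: "equiv S E" "S // E = PP"
    unfolding E_def using assms by (rule equiv_partition_on, rule partition_on_eq_quotient)
  have "h ` S = PP" using E(2) by (auto simp: h_def quotient_def)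
  moreover have "{y \<in> S. h y = h x} = h x" if "x \<in> S" for x
    using that eq_equiv_class_iff[OF E(1)] equiv_type[OF E(1)] by (auto simp: h_def)
  ultimately show thesis using that[of h] by (auto simp: fibres_def)
qed

lemma quotient_eq_fibres:
  assumes "T \<subseteq> S \<times> S"
    and sound: "\<And>x y. (x, y) \<in> T \<Longrightarrow> h x = h y"
    and complete: "\<And>x y. x \<in> S \<Longrightarrow> y \<in> S \<Longrightarrow> h x = h y \<Longrightarrow> (x, y) \<in> (T \<union> T\<inverse>)\<^sup>*"
  shows "S // ((T \<union> T\<inverse>)\<^sup>*) = fibres h S"
proof -
  have closed: "y \<in> S \<and> h y = h x" if "(x, y) \<in> (T \<union> T\<inverse>)\<^sup>*" "x \<in> S" for x y
    using that
  proof (induction rule: rtrancl_induct)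
    case (step y z)
    then show ?case using assms(1) sound[of y z] sound[of z y] by auto
  qed auto
  have "(T \<union> T\<inverse>)\<^sup>* `` {x} = {y \<in> S. h y = h x}" if "x \<in> S" for x
  proof (intro set_eqI iffI)
    fix y assume "y \<in> (T \<union> T\<inverse>)\<^sup>* `` {x}"
    then show "y \<in> {y \<in> S. h y = h x}" using closed that unfolding Image_singleton_iff by simp
  next
    fix y assume "y \<in> {y \<in> S. h y = h x}"
    then show "y \<in> (T \<union> T\<inverse>)\<^sup>* `` {x}" using complete that unfolding Image_singleton_iff by simp
  qed
  then show ?thesis by (auto simp: quotient_def fibres_def)
qed

subsection \<open>Walks and paths\<close>

lemma walk_iff_successively:
  "walk X d fs \<longleftrightarrow> fs \<noteq> [] \<and> set fs \<subseteq> facets X \<and> successively (\<lambda>f g. card (f \<inter> g) = d) fs"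
  by (auto simp: walk_def successively_conv_nth)

lemma walk_singleton: "walk X d [f] \<longleftrightarrow> f \<in> facets X"
  by (simp add: walk_iff_successively)

lemma walk_Cons_Cons:
  "walk X d (f # g # fs) \<longleftrightarrow> f \<in> facets X \<and> card (f \<inter> g) = d \<and> walk X d (g # fs)"
  by (auto simp: walk_iff_successively)

lemma walk_append:
  assumes "xs \<noteq> []" "ys \<noteq> []"
  shows "walk X d (xs @ ys) \<longleftrightarrow> walk X d xs \<and> walk X d ys \<and> card (last xs \<inter> hd ys) = d"
  using assms by (auto simp: walk_iff_successively successively_append_iff)

lemma walk_split: "walk X d (xs @ f # ys) \<longleftrightarrow> walk X d (xs @ [f]) \<and> walk X d (f # ys)"
  by (auto simp: walk_iff_successively successively_append_iff successively_Cons)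

lemma walk_rev: "walk X d (rev fs) \<longleftrightarrow> walk X d fs"
  by (simp add: walk_iff_successively Int_commute)

definition ridges :: "'a set list \<Rightarrow> 'a set list" where
  "ridges fs = map2 (\<inter>) (butlast fs) (tl fs)"

lemma ridges_simps [simp]:
  "ridges [f] = []"
  "ridges (f # g # fs) = (f \<inter> g) # ridges (g # fs)"
  by (simp_all add: ridges_def)

lemma ridges_append: "ridges (xs @ f # ys) = ridges (xs @ [f]) @ ridges (f # ys)"
  by (induction xs rule: induct_list012) simp_all

lemma ridges_rev: "ridges (rev fs) = rev (ridges fs)"
proof (induction fs rule: induct_list012)
  case (3 f g fs)
  have "ridges (rev (f # g # fs)) = ridges (rev (g # fs)) @ [f \<inter> g]"
    using ridges_append[of "rev fs" g "[f]"] by (simp add: Int_commute)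
  then show ?case using 3 by simp
qed (simp_all add: ridges_def)

lemma ridge_split:
  assumes "e \<in> set (ridges fs)"
  shows "\<exists>xs f g ys. fs = xs @ f # g # ys \<and> f \<inter> g = e"
  using assms
proof (induction fs rule: induct_list012)
  case (3 f g fs)
  show ?case
  proof (cases "f \<inter> g = e")
    case True
    then show ?thesis by (metis append_Nil)
  next
    case False
    then show ?thesis using 3 by (metis append_Cons ridges_simps(2) set_ConsD)
  qed
qed (simp_all add: ridges_def)

lemma repeated_ridge_split:
  assumes "\<not> distinct (ridges fs)"
  shows "\<exists>xs f ys g zs. fs = xs @ f # ys @ g # zs \<and> ys \<noteq> [] \<and> f \<inter> hd ys = last ys \<inter> g"
  using assms
proof (induction fs rule: induct_list012)
  case (3 f g fs)
  show ?case
  proof (cases "distinct (ridges (g # fs))")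
    case True
    then have "f \<inter> g \<in> set (ridges (g # fs))" using 3 by simp
    then obtain xs a b ys where "g # fs = xs @ a # b # ys" "a \<inter> b = f \<inter> g"
      using ridge_split by metis
    then have "f # g # fs = [] @ f # (xs @ [a]) @ b # ys \<and> xs @ [a] \<noteq> [] \<and>
        f \<inter> hd (xs @ [a]) = last (xs @ [a]) \<inter> b"
      by (cases xs) auto
    then show ?thesis by blast
  next
    case False
    then show ?thesis using 3 by (metis append_Cons)
  qed
qed (simp_all add: ridges_def)

lemma is_path_iff_ridges: "is_path X d fs \<longleftrightarrow> walk X d fs \<and> distinct (ridges fs)"
proof -
  have "map (\<lambda>i. fs ! i \<inter> fs ! Suc i) [0..<length fs - 1] = ridges fs"
    unfolding ridges_def by (intro nth_equalityI) (auto simp: nth_butlast nth_tl)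
  then show ?thesis by (simp add: is_path_def)
qed

lemma is_path_rev: "is_path X d (rev fs) \<longleftrightarrow> is_path X d fs"
  by (simp add: is_path_iff_ridges walk_rev ridges_rev)

lemma hd_neq_last_split:
  assumes "fs \<noteq> []" "hd fs \<noteq> last fs"
  obtains gs where "fs = hd fs # gs @ [last fs]"
proof -
  have "tl fs \<noteq> []" "last (tl fs) = last fs" using assms by (cases fs; simp split: if_splits)+
  then have "fs = hd fs # butlast (tl fs) @ [last fs]"
    using assms(1) by (metis append_butlast_last_id list.collapse)
  then show thesis by (rule that)
qed

lemma Cons_snoc_simps:
  "last (f # gs @ [g]) = g"
  "(gs @ [g]) ! 0 = hd (gs @ [g])"
  "(f # gs @ [g]) ! length gs = last (f # gs)"
  by (simp_all add: nth_append hd_append hd_conv_nth nth_Cons' last_conv_nth)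

lemma all_nth_Cons_snoc_iff:
  "(\<forall>i. 1 \<le> i \<and> i < Suc (length gs) \<longrightarrow> T ((f # gs @ [g]) ! i)) \<longleftrightarrow> (\<forall>h\<in>set gs. T h)"
proof
  assume nth: "\<forall>i. 1 \<le> i \<and> i < Suc (length gs) \<longrightarrow> T ((f # gs @ [g]) ! i)"
  have "T (gs ! i)" if "i < length gs" for i
    using nth[rule_format, of "Suc i"] that by (simp add: nth_append)
  then show "\<forall>h\<in>set gs. T h" by (auto simp: in_set_conv_nth)
next
  assume "\<forall>h\<in>set gs. T h"
  then show "\<forall>i. 1 \<le> i \<and> i < Suc (length gs) \<longrightarrow> T ((f # gs @ [g]) ! i)"
    by (auto simp: nth_Cons' nth_append)
qed

lemma PhiRel_iff:
  "(f, g) \<in> PhiRel X d VV \<longleftrightarrow> f \<noteq> g \<and>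
     (\<exists>gs. is_path X d (f # gs @ [g]) \<and>
        (\<exists>v w. f - hd (gs @ [g]) = {v} \<and> g - last (f # gs) = {w} \<and>
           (\<exists>P\<in>VV. v \<in> P \<and> w \<in> P \<and> (\<forall>h\<in>set gs. h \<inter> P = {}))))"
    (is "_ \<longleftrightarrow> ?R")
proof
  assume "(f, g) \<in> PhiRel X d VV"
  then obtain fs v w P where path: "f \<noteq> g" "is_path X d fs" "hd fs = f" "last fs = g"
    and vw: "fs ! 0 - fs ! 1 = {v}" "last fs - fs ! (length fs - 2) = {w}"
    and P: "P \<in> VV" "v \<in> P" "w \<in> P"
    and inner: "\<forall>i. 1 \<le> i \<and> i < length fs - 1 \<longrightarrow> fs ! i \<inter> P = {}"
    unfolding PhiRel_def by blast
  obtain gs where fs: "fs = f # gs @ [g]"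
    using hd_neq_last_split[of fs] path by (auto simp: is_path_iff_ridges walk_iff_successively)
  have "\<forall>h\<in>set gs. h \<inter> P = {}"
    using inner all_nth_Cons_snoc_iff[of gs "\<lambda>h. h \<inter> P = {}"] unfolding fs by simp
  moreover have "f - hd (gs @ [g]) = {v}" "g - last (f # gs) = {w}"
    using vw by (simp_all add: fs Cons_snoc_simps del: last.simps)
  ultimately show ?R using path(1,2) P unfolding fs by blast
next
  assume ?R
  then obtain gs v w P where "f \<noteq> g" and path: "is_path X d (f # gs @ [g])"
    and vw: "f - hd (gs @ [g]) = {v}" "g - last (f # gs) = {w}"
    and P: "P \<in> VV" "v \<in> P" "w \<in> P" and inner: "\<forall>h\<in>set gs. h \<inter> P = {}"
    by (elim conjE exE bexE) (rule that)
  define fs where "fs = f # gs @ [g]"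
  have "f \<in> facets X" "g \<in> facets X"
    using path by (simp_all add: is_path_iff_ridges walk_iff_successively)
  moreover have "is_path X d fs" "hd fs = f" "last fs = g" "2 \<le> length fs"
    using path by (simp_all add: fs_def)
  moreover have "fs ! 0 - fs ! 1 = {v}" "last fs - fs ! (length fs - 2) = {w}"
    using vw by (simp_all add: fs_def Cons_snoc_simps del: last.simps)
  moreover have "\<forall>i. 1 \<le> i \<and> i < length fs - 1 \<longrightarrow> fs ! i \<inter> P = {}"
    using inner all_nth_Cons_snoc_iff[of gs "\<lambda>h. h \<inter> P = {}"] by (simp add: fs_def)
  ultimately show "(f, g) \<in> PhiRel X d VV" using \<open>f \<noteq> g\<close> P unfolding PhiRel_def by blast
qed

lemma PsiRel_iff:
  "(v, w) \<in> PsiRel X d FF \<longleftrightarrow>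
     (v \<in> vertices X \<and> w \<in> vertices X \<and> v \<noteq> w \<and> \<not> (\<exists>f\<in>facets X. v \<in> f \<and> w \<in> f)) \<and>
     (\<exists>f gs g. is_path X d (f # gs @ [g]) \<and> v \<in> f \<and> v \<notin> hd (gs @ [g]) \<and> w \<in> g \<and> w \<notin> last (f # gs) \<and>
        (\<exists>Q\<in>FF. f \<in> Q \<and> g \<in> Q \<and> (\<forall>h\<in>set gs. h \<notin> Q)))"
    (is "_ \<longleftrightarrow> ?V \<and> ?R")
proof
  assume "(v, w) \<in> PsiRel X d FF"
  then obtain fs Q where ?V and path: "is_path X d fs" and vw: "v \<in> hd fs" "w \<in> last fs"
    "2 \<le> length fs \<Longrightarrow> v \<notin> fs ! 0 \<inter> fs ! 1 \<and> w \<notin> last fs \<inter> fs ! (length fs - 2)"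
    and Q: "Q \<in> FF" "hd fs \<in> Q" "last fs \<in> Q"
    and inner: "\<forall>i. 1 \<le> i \<and> i < length fs - 1 \<longrightarrow> fs ! i \<notin> Q"
    unfolding PsiRel_def by blast
  have "fs \<noteq> []" "hd fs \<in> facets X"
    using path by (auto simp: is_path_iff_ridges walk_iff_successively)
  then have "hd fs \<noteq> last fs" using \<open>?V\<close> vw(1,2) by metis
  then obtain f gs g where fs: "fs = f # gs @ [g]" using hd_neq_last_split[OF \<open>fs \<noteq> []\<close>] by metis
  have "\<forall>h\<in>set gs. h \<notin> Q"
    using inner all_nth_Cons_snoc_iff[of gs "\<lambda>h. h \<notin> Q"] unfolding fs by simp
  moreover have "v \<in> f" "w \<in> g" "f \<in> Q" "g \<in> Q" using vw(1,2) Q(2,3) by (simp_all add: fs)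
  moreover have "v \<notin> hd (gs @ [g])" "w \<notin> last (f # gs)"
    using vw by (simp_all add: fs Cons_snoc_simps del: last.simps)
  ultimately show "?V \<and> ?R" using \<open>?V\<close> path Q(1) unfolding fs by blast
next
  assume "?V \<and> ?R"
  then obtain f gs g Q where ?V and path: "is_path X d (f # gs @ [g])"
    and v: "v \<in> f" "v \<notin> hd (gs @ [g])" and w: "w \<in> g" "w \<notin> last (f # gs)"
    and Q: "Q \<in> FF" "f \<in> Q" "g \<in> Q" and inner: "\<forall>h\<in>set gs. h \<notin> Q"
    by (elim conjE exE bexE) (rule that, blast+)
  define fs where "fs = f # gs @ [g]"
  have "is_path X d fs" "v \<in> hd fs" "w \<in> last fs" "hd fs \<in> Q" "last fs \<in> Q"
    using path v(1) w(1) Q(2,3) by (simp_all add: fs_def)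
  moreover have "v \<notin> fs ! 0 \<inter> fs ! 1 \<and> w \<notin> last fs \<inter> fs ! (length fs - 2)"
    using v(2) w(2) by (simp add: fs_def Cons_snoc_simps del: last.simps)
  moreover have "\<forall>i. 1 \<le> i \<and> i < length fs - 1 \<longrightarrow> fs ! i \<notin> Q"
    using inner all_nth_Cons_snoc_iff[of gs "\<lambda>h. h \<notin> Q"] by (simp add: fs_def)
  ultimately show "(v, w) \<in> PsiRel X d FF" using \<open>?V\<close> Q(1) unfolding PsiRel_def by blast
qed

subsection \<open>Stacked complexes\<close>

locale stacked_complex =
  fixes X :: "'a set set" and d :: nat
  assumes stacked: "stacked X d"
begin

lemma card_facet: "f \<in> facets X \<Longrightarrow> card f = Suc d"
  using stacked by (simp add: stacked_def pure_def)

lemma finite_facet: "f \<in> facets X \<Longrightarrow> finite f"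
  using card_facet by (simp add: card_ge_0_finite)

lemma facets_nonempty: "facets X \<noteq> {}"
  using stacked by (auto simp: stacked_def)

lemma vertices_eq_Union_facets: "vertices X = \<Union>(facets X)"
proof
  show "vertices X \<subseteq> \<Union>(facets X)"
  proof
    fix v assume "v \<in> vertices X"
    then obtain x where x: "x \<in> X" "v \<in> x" by (auto simp: vertices_def)
    have "finite (\<Union>X)" using stacked by (simp add: stacked_def simplicial_complex_def)
    then have "finite X" by (rule finite_UnionD)
    then obtain m where "m \<in> X" "x \<subseteq> m" "\<forall>y\<in>X. m \<subseteq> y \<longrightarrow> m = y"
      using finite_has_maximal2[OF _ x(1)] by metis
    then show "v \<in> \<Union>(facets X)" using x by (auto simp: facets_def)
  qed
qed (auto simp: vertices_def facets_def)

lemma walk_ends_Diff: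
  assumes w: "walk X d (f # gs @ [g])"
  shows "\<exists>v w. f - hd (gs @ [g]) = {v} \<and> g - last (f # gs) = {w}"
proof -
  have "f \<in> facets X" "g \<in> facets X" using w by (simp_all add: walk_iff_successively)
  moreover have "card (f \<inter> hd (gs @ [g])) = d" "card (g \<inter> last (f # gs)) = d"
    using w walk_append[of "[f]" "gs @ [g]" X d] walk_append[of "f # gs" "[g]" X d]
    by (simp_all add: Int_commute)
  ultimately show ?thesis using Diff_eq_singleton_of_card_Int card_facet by metis
qed

lemma stacking_induct [case_names base step]:
  assumes base: "\<And>f. f \<in> facets X \<Longrightarrow> T {f}"
    and step: "\<And>S f h v. S \<subseteq> facets X \<Longrightarrow> f \<in> facets X \<Longrightarrow> h \<in> S \<Longrightarrow> v \<in> f \<Longrightarrow> v \<notin> \<Union>S \<Longrightarrow>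
      f - {v} \<subseteq> h \<Longrightarrow> T S \<Longrightarrow> T (insert f S)"
  shows "T (facets X)"
proof -
  obtain fs where fs: "fs \<noteq> []" "set fs = facets X"
    and order: "\<forall>p. 1 \<le> p \<and> p < length fs \<longrightarrow>
      (\<exists>v. fs ! p - \<Union>(set (take p fs)) = {v} \<and> (\<exists>j<p. fs ! p - {v} \<subseteq> fs ! j))"
    using stacked unfolding stacked_def by auto
  have "T (set (take (Suc p) fs))" if "p < length fs" for p
    using that
  proof (induction p)
    case 0
    then show ?case using fs base[of "hd fs"] by (cases fs) auto
  next
    case (Suc p)
    obtain v j where v: "fs ! Suc p - \<Union>(set (take (Suc p) fs)) = {v}" "j < Suc p"
      "fs ! Suc p - {v} \<subseteq> fs ! j"
      using order Suc.prems by auto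
    have "T (insert (fs ! Suc p) (set (take (Suc p) fs)))"
    proof (rule step[where h = "fs ! j" and v = v])
      show "set (take (Suc p) fs) \<subseteq> facets X" using fs(2) set_take_subset by fastforce
      show "fs ! Suc p \<in> facets X" using fs(2) Suc.prems nth_mem by blast
      show "fs ! j \<in> set (take (Suc p) fs)" using v(2) Suc.prems by (auto simp: in_set_conv_nth)
    qed (use v Suc in auto)
    then show ?case using Suc.prems by (simp add: take_Suc_conv_app_nth[of "Suc p"])
  qed
  from this[of "length fs - 1"] show ?thesis using fs by simp
qed

lemma exists_walk:
  assumes "f \<in> facets X" "g \<in> facets X"
  shows "\<exists>fs. walk X d fs \<and> hd fs = f \<and> last fs = g"
proof -
  have "\<forall>f\<in>facets X. \<forall>g\<in>facets X. \<exists>fs. walk X d fs \<and> hd fs = f \<and> last fs = g"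
  proof (induction rule: stacking_induct)
    case (base f)
    then show ?case by (auto intro!: exI[of _ "[f]"] simp: walk_singleton)
  next
    case (step S f h v)
    have "f \<inter> h = f - {v}" using step by auto
    then have fh: "card (f \<inter> h) = d" using step card_facet finite_facet by simp
    have from_f: "\<exists>fs. walk X d fs \<and> hd fs = f \<and> last fs = g" if g: "g \<in> S" for g
    proof -
      obtain fs where fs: "walk X d fs" "hd fs = h" "last fs = g"
        using step(7)[rule_format, OF step(3) g] by blast
      then have "fs \<noteq> []" by (simp add: walk_iff_successively)
      then have "walk X d (f # fs)"
        using fs step(2) fh walk_append[of "[f]" fs] by (simp add: walk_singleton)
      then show ?thesis using fs \<open>fs \<noteq> []\<close> by (intro exI[of _ "f # fs"]) simp
    qed
    have to_f: "\<exists>fs. walk X d fs \<and> hd fs = g \<and> last fs = f" if "g \<in> S" for g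
      using from_f[OF that] by (metis hd_rev last_rev walk_rev)
    have "\<exists>fs. walk X d fs \<and> hd fs = f \<and> last fs = f"
      using step(2) by (intro exI[of _ "[f]"]) (simp add: walk_singleton)
    then show ?case using to_f from_f step(7) by simp
  qed
  then show ?thesis using assms by blast
qed

lemma shortest_walk_is_path:
  assumes w: "walk X d fs"
    and shortest: "\<And>gs. walk X d gs \<Longrightarrow> hd gs = hd fs \<Longrightarrow> last gs = last fs \<Longrightarrow> length fs \<le> length gs"
  shows "is_path X d fs"
proof (rule ccontr)
  assume "\<not> is_path X d fs"
  then obtain xs f ys g zs where fs: "fs = xs @ f # ys @ g # zs" "ys \<noteq> []"
    and ridge: "f \<inter> hd ys = last ys \<inter> g"
    using w repeated_ridge_split unfolding is_path_iff_ridges by metis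
  have walks: "walk X d (xs @ [f])" "walk X d (f # ys)" "walk X d (g # zs)"
    using w walk_split[of X d xs f "ys @ g # zs"] walk_split[of X d "f # ys" g zs]
      walk_append[of "f # ys" "g # zs"] by (auto simp: fs)
  have "card (f \<inter> hd ys) = d" using walks(2) fs(2) walk_append[of "[f]" ys] by simp
  show False
  proof (cases "f = g")
    case True
    then have "walk X d (xs @ f # zs)" using walks walk_split by blast
    then have "length fs \<le> length (xs @ f # zs)"
      by (rule shortest) (use fs True in \<open>cases xs; simp\<close>)+
    then show False by (simp add: fs)
  next
    case False
    have "f \<in> facets X" "g \<in> facets X" using w by (simp_all add: walk_iff_successively fs)
    then have "card (f \<inter> g) = d"
      using Int_eq_of_card_Suc[OF card_facet card_facet False, of "f \<inter> hd ys"]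
        \<open>card (f \<inter> hd ys) = d\<close> ridge by (metis Int_lower1 Int_lower2)
    then have "walk X d (xs @ f # g # zs)"
      using walks \<open>f \<in> facets X\<close> walk_split[of X d xs f "g # zs"] by (simp add: walk_Cons_Cons)
    then have "length fs \<le> length (xs @ f # g # zs)"
      by (rule shortest) (use fs in \<open>cases xs; simp\<close>)+
    then show False using fs by simp
  qed
qed

lemma adjacent_Int_eq_Diff:
  assumes "f \<in> facets X" "v \<in> f" "v \<notin> g" "card (f \<inter> g) = d"
  shows "f \<inter> g = f - {v}"
proof (rule card_subset_eq)
  show "card (f \<inter> g) = card (f - {v})" using assms card_facet by simp
qed (use assms finite_facet in auto)

text \<open>In a walk through facets among which only \<open>f\<close> contains \<open>v\<close>, every neighbour of \<open>f\<close> meets it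
  in \<open>f - {v}\<close>. So in a path, \<open>f\<close> occurs only once, at an end.\<close>

lemma ridge_of_new_facet:
  assumes w: "walk X d fs" and "set fs \<subseteq> insert f S" and v: "v \<in> f" "v \<notin> \<Union>S"
    and f: "f \<in> set fs" "fs \<noteq> [f]"
  shows "f - {v} \<in> set (ridges fs)"
proof -
  have fX: "f \<in> facets X" using w f(1) by (auto simp: walk_iff_successively)
  have neighbour: "f \<inter> g = f - {v}" if "g \<in> set fs" "card (f \<inter> g) = d" for g
  proof -
    have "g \<noteq> f" using that(2) card_facet[OF fX] by auto
    then show ?thesis using that assms fX by (intro adjacent_Int_eq_Diff) auto
  qed
  obtain xs ys where fs: "fs = xs @ f # ys" using f(1) by (meson split_list)
  show ?thesis
  proof (cases ys)
    case (Cons g zs)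
    then have "card (f \<inter> g) = d" using w walk_split[of X d xs f ys] by (simp add: fs walk_Cons_Cons)
    then have "f \<inter> g = f - {v}" by (intro neighbour) (simp_all add: fs Cons)
    then show ?thesis using ridges_append[of xs f ys] by (simp add: fs Cons)
  next
    case Nil
    then obtain zs g where xs: "xs = zs @ [g]" using f(2) fs by (cases xs rule: rev_cases) auto
    then have "card (f \<inter> g) = d"
      using w walk_split[of X d zs g "[f]"] by (simp add: fs Nil walk_Cons_Cons Int_commute)
    then have "f \<inter> g = f - {v}" by (intro neighbour) (simp_all add: fs xs)
    then show ?thesis using ridges_append[of zs g "[f]"] by (simp add: fs Nil xs Int_commute)
  qed
qed

lemma new_facet_at_path_end:
  assumes path: "is_path X d (xs @ f # ys)" and sub: "set (xs @ f # ys) \<subseteq> insert f S"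
    and v: "v \<in> f" "v \<notin> \<Union>S"
  shows "xs = [] \<or> ys = []"
proof (rule ccontr)
  assume ends: "\<not> ?thesis"
  have "walk X d (xs @ [f])" "walk X d (f # ys)"
    using path walk_split[of X d xs f ys] by (simp_all add: is_path_iff_ridges)
  then have "f - {v} \<in> set (ridges (xs @ [f])) \<inter> set (ridges (f # ys))"
    using ends sub v by (intro IntI ridge_of_new_facet) auto
  moreover have "distinct (ridges (xs @ [f]) @ ridges (f # ys))"
    using path by (simp add: is_path_iff_ridges flip: ridges_append)
  ultimately show False by auto
qed

lemma is_path_Cons: "is_path X d (f # g # fs) \<Longrightarrow> is_path X d (g # fs)"
  by (simp add: is_path_iff_ridges walk_Cons_Cons)

definition path_convex :: "'a \<Rightarrow> 'a set set \<Rightarrow> bool" where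
  "path_convex v S \<longleftrightarrow>
     (\<forall>fs. is_path X d fs \<longrightarrow> set fs \<subseteq> S \<longrightarrow> v \<in> hd fs \<longrightarrow> v \<in> last fs \<longrightarrow> (\<forall>g\<in>set fs. v \<in> g))"

lemma path_convexD:
  "path_convex v S \<Longrightarrow> is_path X d fs \<Longrightarrow> set fs \<subseteq> S \<Longrightarrow> v \<in> hd fs \<Longrightarrow> v \<in> last fs \<Longrightarrow> g \<in> set fs \<Longrightarrow>
    v \<in> g"
  unfolding path_convex_def by blast

lemma path_convex_from_new_facet:
  assumes convex: "path_convex v S" and path: "is_path X d (f # fs)" and sub: "set fs \<subseteq> insert f S"
    and x: "x \<in> f" "x \<notin> \<Union>S" and v: "v \<in> f" "v \<in> last (f # fs)"
  shows "\<forall>g\<in>set (f # fs). v \<in> g"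
proof (cases fs)
  case (Cons g gs)
  have w: "walk X d fs" "card (f \<inter> g) = d" and f: "f \<in> facets X"
    using path by (simp_all add: is_path_iff_ridges Cons walk_Cons_Cons)
  have "g \<noteq> f" using w(2) card_facet[OF f] by auto
  then have "x \<notin> g" using x(2) sub by (auto simp: Cons)
  then have fg: "f \<inter> g = f - {x}" using f x(1) w(2) by (intro adjacent_Int_eq_Diff)
  then have "f - {x} \<notin> set (ridges fs)"
    using path by (simp add: is_path_iff_ridges Cons)
  then have "f \<notin> set fs"
    using ridge_of_new_facet[OF w(1) sub x] \<open>g \<noteq> f\<close> by (auto simp: Cons)
  then have S: "set fs \<subseteq> S" using sub by auto
  have last: "v \<in> last fs" using v(2) by (simp add: Cons)
  then have "v \<noteq> x" using x(2) S last_in_set[of fs] by (auto simp: Cons)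
  then have "v \<in> hd fs" using v(1) fg by (auto simp: Cons)
  moreover have "is_path X d fs" using path is_path_Cons by (simp add: Cons)
  ultimately show ?thesis using path_convexD[OF convex _ S _ last] v(1) by simp
qed (use v in simp)

lemma path_convex_insert:
  assumes convex: "path_convex v S" and x: "x \<in> f" "x \<notin> \<Union>S"
  shows "path_convex v (insert f S)"
  unfolding path_convex_def
proof (intro allI impI)
  fix fs assume path: "is_path X d fs" and sub: "set fs \<subseteq> insert f S" and v: "v \<in> hd fs" "v \<in> last fs"
  show "\<forall>g\<in>set fs. v \<in> g"
  proof (cases "f \<in> set fs")
    case True
    then obtain xs ys where fs: "fs = xs @ f # ys" by (meson split_list)
    consider (first) "xs = []" | (last) "ys = []"
      using new_facet_at_path_end path sub x unfolding fs by blast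
    then show ?thesis
    proof cases
      case first
      then show ?thesis
        using path_convex_from_new_facet[OF convex _ _ x, of ys] path sub v by (simp add: fs)
    next
      case last
      then have rev: "f # rev xs = rev fs" by (simp add: fs)
      have "\<forall>g\<in>set (f # rev xs). v \<in> g"
      proof (rule path_convex_from_new_facet[OF convex _ _ x])
        show "is_path X d (f # rev xs)" using path unfolding rev is_path_rev .
        show "set (rev xs) \<subseteq> insert f S" using sub by (simp add: fs)
        show "v \<in> f" using v(2) by (simp add: fs last)
        show "v \<in> last (f # rev xs)" using v(1) unfolding rev last_rev .
      qed
      then show ?thesis by (simp add: fs last)
    qed
  next
    case False
    then have "set fs \<subseteq> S" using sub by auto
    then show ?thesis using path_convexD[OF convex path _ v] by blast
  qed
qed

lemma path_convex_facets: "path_convex v (facets X)"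
proof (induction rule: stacking_induct)
  case (base f)
  show ?case
    unfolding path_convex_def
  proof (intro allI impI)
    fix fs assume fs: "is_path X d fs" "set fs \<subseteq> {f}" "v \<in> hd fs"
    then have "hd fs = f" by (cases fs) (auto simp: is_path_iff_ridges walk_iff_successively)
    then show "\<forall>g\<in>set fs. v \<in> g" using fs by auto
  qed
next
  case (step S f h x)
  then show ?case by (intro path_convex_insert)
qed

lemma path_left_vertex_notin_last:
  assumes "is_path X d (f # gs @ [g])" "v \<in> f" "v \<notin> hd (gs @ [g])"
  shows "v \<notin> g"
proof
  assume "v \<in> g"
  have "set (f # gs @ [g]) \<subseteq> facets X"
    using assms(1) unfolding is_path_iff_ridges walk_iff_successively by blast
  then have "v \<in> hd (gs @ [g])"
    using path_convexD[OF path_convex_facets assms(1), of v "hd (gs @ [g])"] assms(2) \<open>v \<in> g\<close>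
    by (cases gs) auto
  then show False using assms(3) by simp
qed

subsection \<open>Separation and links\<close>

text \<open>The incidence \<open>I\<close> is equality for a labelling \<open>k\<close> of the facets, and membership for a colouring
  \<open>k\<close> of the vertices.\<close>

definition proper :: "('b \<Rightarrow> 'a set \<Rightarrow> bool) \<Rightarrow> ('b \<Rightarrow> 'c) \<Rightarrow> bool" where
  "proper I k \<longleftrightarrow> (\<forall>f\<in>facets X. inj_on k {x. I x f})"

definition separated :: "('b \<Rightarrow> 'a set \<Rightarrow> bool) \<Rightarrow> ('b \<Rightarrow> 'c) \<Rightarrow> nat \<Rightarrow> bool" where
  "separated I k n \<longleftrightarrow>
     (\<forall>fs x y. walk X d fs \<longrightarrow> I x (hd fs) \<longrightarrow> I y (last fs) \<longrightarrow> x \<noteq> y \<longrightarrow> k x = k y \<longrightarrow> n \<le> length fs)"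

definition link :: "('b \<Rightarrow> 'a set \<Rightarrow> bool) \<Rightarrow> ('b \<Rightarrow> 'c) \<Rightarrow> 'a set list \<Rightarrow> 'b \<Rightarrow> 'b \<Rightarrow> bool" where
  "link I k fs x y \<longleftrightarrow> is_path X d fs \<and> x \<noteq> y \<and> k x = k y \<and>
     (\<exists>f gs g. fs = f # gs @ [g] \<and> I x f \<and> \<not> I x (hd (gs @ [g])) \<and> I y g \<and> \<not> I y (last (f # gs)) \<and>
        (\<forall>h\<in>set gs. \<forall>z. I z h \<longrightarrow> k z \<noteq> k x))"

lemma proper_eq: "proper (=) k"
  by (simp add: proper_def)

lemma separated_imp_proper:
  assumes "separated I k n" "2 \<le> n"
  shows "proper I k"
  unfolding proper_def
proof (intro ballI inj_onI)
  fix f x y assume "f \<in> facets X" "x \<in> {x. I x f}" "y \<in> {x. I x f}" "k x = k y"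
  then have "x \<noteq> y \<Longrightarrow> n \<le> length [f]"
    using assms(1) walk_singleton[of X d f] unfolding separated_def
    by (metis last.simps list.sel(1) mem_Collect_eq)
  then show "x = y" using assms(2) by auto
qed

lemma link_eq_iff:
  "link (=) \<phi> fs f g \<longleftrightarrow> is_path X d fs \<and> f \<noteq> g \<and> \<phi> f = \<phi> g \<and>
     (\<exists>gs. fs = f # gs @ [g] \<and> (\<forall>h\<in>set gs. \<phi> h \<noteq> \<phi> f))"
proof -
  have "f \<noteq> hd (gs @ [g]) \<and> g \<noteq> last (f # gs)"
    if "f \<noteq> g" "\<phi> f = \<phi> g" "\<forall>h\<in>set gs. \<phi> h \<noteq> \<phi> f" for gs
    using that by (cases gs) (auto dest: last_in_set)
  then show ?thesis unfolding link_def by blast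
qed

lemma link_mem_iff:
  "link (\<in>) c fs v w \<longleftrightarrow> is_path X d fs \<and> v \<noteq> w \<and> c v = c w \<and>
     (\<exists>f gs g. fs = f # gs @ [g] \<and> v \<in> f \<and> v \<notin> hd (gs @ [g]) \<and> w \<in> g \<and> w \<notin> last (f # gs) \<and>
        (\<forall>h\<in>set gs. c v \<notin> c ` h))"
  unfolding link_def image_iff by (metis (no_types))

lemma proper_walk_split:
  assumes "proper I k" "walk X d fs" "I x (hd fs)" "I y (last fs)" "k x = k y" "x \<noteq> y"
  obtains f gs g where "fs = f # gs @ [g]"
proof -
  have "fs \<noteq> []" "hd fs \<in> facets X" using assms(2) by (auto simp: walk_iff_successively)
  moreover have "hd fs \<noteq> last fs"
    using assms \<open>hd fs \<in> facets X\<close> unfolding proper_def by (auto dest!: bspec inj_onD)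
  ultimately show thesis using hd_neq_last_split that by metis
qed

text \<open>The case \<open>splits\<close> includes degenerate splittings, with \<open>z = x\<close> or \<open>z = y\<close> and one of the walks
  reduced to a single facet.\<close>

lemma walk_link_cases:
  assumes w: "walk X d fs" and x: "I x (hd fs)" and y: "I y (last fs)" and k: "k x = k y"
    and "x \<noteq> y" and proper: "proper I k"
  obtains (link) "link I k fs x y"
  | (splits) z gs hs where
      "walk X d gs" "length gs < length fs" "I x (hd gs)" "I z (last gs)" "k x = k z"
      "walk X d hs" "length hs < length fs" "I z (hd hs)" "I y (last hs)" "k z = k y"
proof -
  obtain f gs g where fs: "fs = f # gs @ [g]"
    using proper w x y k \<open>x \<noteq> y\<close> by (rule proper_walk_split)
  have fg: "walk X d [f]" "walk X d [g]" "I x f" "I y g"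
    using w x y by (simp_all add: fs walk_iff_successively)
  consider (shortcut) hs where "walk X d hs" "hd hs = hd fs" "last hs = last fs" "length hs < length fs"
    | (inner) h z where "h \<in> set gs" "I z h" "k z = k x"
    | (left) "I x (hd (gs @ [g]))"
    | (right) "I y (last (f # gs))"
    | (none) "\<And>hs. walk X d hs \<Longrightarrow> hd hs = hd fs \<Longrightarrow> last hs = last fs \<Longrightarrow> length fs \<le> length hs"
      "\<forall>h\<in>set gs. \<forall>z. I z h \<longrightarrow> k z \<noteq> k x" "\<not> I x (hd (gs @ [g]))" "\<not> I y (last (f # gs))"
    by (meson not_le)
  then show thesis
  proof cases
    case (shortcut hs)
    then show thesis using splits[of hs y "[g]"] x y k fg by (simp add: fs)
  next
    case (inner h z)
    obtain as bs where gs: "gs = as @ h # bs" using split_list[OF inner(1)] by blast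
    have "walk X d (f # as @ [h])" "walk X d (h # bs @ [g])"
      using w walk_split[of X d "f # as" h "bs @ [g]"] by (simp_all add: fs gs)
    then show thesis
      using splits[of "f # as @ [h]" z "h # bs @ [g]"] inner(2,3) k fg by (simp add: fs gs)
  next
    case left
    have "walk X d (gs @ [g])" using w walk_append[of "[f]" "gs @ [g]" X d] by (simp add: fs)
    then show thesis using splits[of "[f]" x "gs @ [g]"] left k fg by (simp add: fs)
  next
    case right
    have "walk X d (f # gs)" using w walk_append[of "f # gs" "[g]" X d] by (simp add: fs)
    then show thesis using splits[of "f # gs" y "[g]"] right k fg by (simp add: fs)
  next
    case none
    have "is_path X d fs" using none(1) by (rule shortest_walk_is_path[OF w])
    then show thesis
      using none(2-4) fg(3,4) k \<open>x \<noteq> y\<close> link unfolding link_def fs by blast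
  qed
qed

lemma link_chain:
  assumes proper: "proper I k"
    and "walk X d fs" "length fs \<le> n" "I x (hd fs)" "I y (last fs)" "k x = k y"
  shows "(x, y) \<in> {(x, y). \<exists>fs. length fs \<le> n \<and> link I k fs x y}\<^sup>*"
    (is "_ \<in> ?L\<^sup>*")
  using assms(2-)
proof (induction "length fs" arbitrary: fs x y rule: less_induct)
  case less
  show ?case
  proof (cases "x = y")
    case False
    from less.prems(1,3-5) False proper show ?thesis
    proof (cases rule: walk_link_cases)
      case link
      then show ?thesis using less.prems(2) by auto
    next
      case (splits z gs hs)
      have "(x, z) \<in> ?L\<^sup>*" using splits less.prems(2) by (intro less.hyps[of gs]) simp_all
      moreover have "(z, y) \<in> ?L\<^sup>*" using splits less.prems(2) by (intro less.hyps[of hs]) simp_all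
      ultimately show ?thesis by (rule rtrancl_trans)
    qed
  qed simp
qed

lemma separated_iff_link:
  assumes proper: "proper I k"
  shows "separated I k n \<longleftrightarrow> (\<forall>fs x y. link I k fs x y \<longrightarrow> n \<le> length fs)"
proof
  assume "separated I k n"
  then show "\<forall>fs x y. link I k fs x y \<longrightarrow> n \<le> length fs"
    unfolding separated_def link_def is_path_iff_ridges by fastforce
next
  assume long: "\<forall>fs x y. link I k fs x y \<longrightarrow> n \<le> length fs"
  show "separated I k n"
    unfolding separated_def
  proof (intro allI impI)
    fix fs x y
    assume xy: "walk X d fs" "I x (hd fs)" "I y (last fs)" "x \<noteq> y" "k x = k y"
    then have "(x, y) \<in> {(x, y). \<exists>gs. length gs \<le> length fs \<and> link I k gs x y}\<^sup>*"
      by (intro link_chain[OF proper]) simp_all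
    then obtain gs x' y' where "length gs \<le> length fs" "link I k gs x' y'"
      using xy(4) by (auto elim: converse_rtranclE)
    then show "n \<le> length fs" using long by (meson order_trans)
  qed
qed

lemma quotient_links:
  assumes proper: "proper I k"
    and S: "S = {x. \<exists>f\<in>facets X. I x f}" and T: "T = {(x, y). \<exists>fs. link I k fs x y}"
  shows "S // ((T \<union> T\<inverse>)\<^sup>*) = fibres k S"
proof (rule quotient_eq_fibres)
  show "T \<subseteq> S \<times> S"
    unfolding T S link_def by (auto simp: is_path_iff_ridges walk_iff_successively)
  show "k x = k y" if "(x, y) \<in> T" for x y
    using that by (auto simp: T link_def)
  fix x y assume "x \<in> S" "y \<in> S" "k x = k y"
  then obtain f g where fg: "f \<in> facets X" "I x f" "g \<in> facets X" "I y g" unfolding S by blast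
  obtain fs where fs: "walk X d fs" "hd fs = f" "last fs = g" using exists_walk fg by blast
  have "(x, y) \<in> {(x, y). \<exists>gs. length gs \<le> length fs \<and> link I k gs x y}\<^sup>*"
    by (rule link_chain[OF proper fs(1) order_refl]) (simp_all add: fs fg \<open>k x = k y\<close>)
  then show "(x, y) \<in> (T \<union> T\<inverse>)\<^sup>*"
    by (rule rtrancl_mono[THEN subsetD, rotated]) (auto simp: T)
qed

lemma vertex_scattered_fibres_iff:
  "(\<forall>P\<in>fibres c (vertices X). vertex_scattered X d s P) \<longleftrightarrow> separated (\<in>) c s"
proof
  assume scattered: "\<forall>P\<in>fibres c (vertices X). vertex_scattered X d s P"
  show "separated (\<in>) c s"
    unfolding separated_def
  proof (intro allI impI)
    fix fs v w assume fs: "walk X d fs" "v \<in> hd fs" "w \<in> last fs" "v \<noteq> w" "c v = c w"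
    have "hd fs \<in> facets X" "last fs \<in> facets X" using fs(1) by (auto simp: walk_iff_successively)
    then have "v \<in> vertices X" "w \<in> vertices X"
      using fs(2,3) unfolding vertices_eq_Union_facets by blast+
    moreover from this have "vertex_scattered X d s {u \<in> vertices X. c u = c v}"
      using scattered by (auto simp: fibres_def)
    ultimately have "enat s \<le> vertex_dist X d v w" using fs by (auto simp: vertex_scattered_def)
    then show "s \<le> length fs" using fs by (auto simp: vertex_dist_def le_INF_iff)
  qed
qed (auto simp: separated_def vertex_scattered_def vertex_dist_def le_INF_iff fibres_def)

lemma facet_scattered_fibres_iff:
  "(\<forall>Q\<in>fibres \<phi> (facets X). facet_scattered X d s Q) \<longleftrightarrow> separated (=) \<phi> (Suc s)"
proof
  assume scattered: "\<forall>Q\<in>fibres \<phi> (facets X). facet_scattered X d s Q"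
  have "Suc s \<le> length fs" if fs: "walk X d fs" "hd fs \<noteq> last fs" "\<phi> (hd fs) = \<phi> (last fs)" for fs
  proof -
    have "fs \<noteq> []" "hd fs \<in> facets X" "last fs \<in> facets X"
      using fs(1) by (auto simp: walk_iff_successively)
    moreover from this have "facet_scattered X d s {g \<in> facets X. \<phi> g = \<phi> (hd fs)}"
      using scattered by (auto simp: fibres_def)
    ultimately have "enat s \<le> facet_dist X d (hd fs) (last fs)"
      using fs by (auto simp: facet_scattered_def)
    then have "s \<le> length fs - 1" using fs by (auto simp: facet_dist_def le_INF_iff)
    then show ?thesis using \<open>fs \<noteq> []\<close> by (cases fs) auto
  qed
  then show "separated (=) \<phi> (Suc s)" by (auto simp: separated_def)
qed (fastforce simp: separated_def facet_scattered_def facet_dist_def le_INF_iff fibres_def)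

definition scattered_vertex_partitions :: "nat \<Rightarrow> nat \<Rightarrow> 'a set set set" where
  "scattered_vertex_partitions n s =
     {VV. partition_on (vertices X) VV \<and> card VV = n \<and> (\<forall>P\<in>VV. vertex_scattered X d s P)}"

definition scattered_facet_partitions :: "nat \<Rightarrow> nat \<Rightarrow> 'a set set set set" where
  "scattered_facet_partitions n s =
     {FF. partition_on (facets X) FF \<and> card FF = n \<and> (\<forall>Q\<in>FF. facet_scattered X d s Q)}"

lemma bex_vertex_fibres_iff:
  assumes w: "walk X d (f # gs @ [g])" and "v \<in> f" "w \<in> g"
  shows "(\<exists>P\<in>fibres c (vertices X). v \<in> P \<and> w \<in> P \<and> (\<forall>h\<in>set gs. h \<inter> P = {})) \<longleftrightarrow>
    c v = c w \<and> (\<forall>h\<in>set gs. c v \<notin> c ` h)"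
proof -
  have sub: "h \<subseteq> vertices X" if "h \<in> set (f # gs @ [g])" for h
    using w that unfolding vertices_eq_Union_facets walk_iff_successively by blast
  have "h \<inter> {u \<in> vertices X. c u = c v} = {} \<longleftrightarrow> c v \<notin> c ` h" if "h \<in> set gs" for h
    using sub[of h] that by (auto simp: disjoint_iff image_iff)
  then show ?thesis
    using assms(2,3) sub[of f] sub[of g]
      bex_fibres_iff[of c "vertices X" v w "\<lambda>P. \<forall>h\<in>set gs. h \<inter> P = {}"] by (simp add: subset_iff)
qed

lemma bex_facet_fibres_iff:
  assumes "walk X d (f # gs @ [g])"
  shows "(\<exists>Q\<in>fibres \<phi> (facets X). f \<in> Q \<and> g \<in> Q \<and> (\<forall>h\<in>set gs. h \<notin> Q)) \<longleftrightarrow>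
    \<phi> f = \<phi> g \<and> (\<forall>h\<in>set gs. \<phi> h \<noteq> \<phi> f)"
proof -
  have "f \<in> facets X" "g \<in> facets X" "\<forall>h\<in>set gs. h \<in> facets X"
    using assms by (auto simp: walk_iff_successively)
  then show ?thesis
    using bex_fibres_iff[of \<phi> "facets X" f g "\<lambda>Q. \<forall>h\<in>set gs. h \<notin> Q"] by auto
qed

end

subsection \<open>Couplings of vertex colourings and facet labellings\<close>

definition collapses :: "'n set \<Rightarrow> 'r set \<Rightarrow> ('n \<Rightarrow> 'r) \<Rightarrow> 'n set \<Rightarrow> 'r \<Rightarrow> bool" where
  "collapses N R a D q \<longleftrightarrow>
     D \<subseteq> N \<and> q \<in> R \<and> (\<forall>P\<in>D. a P = q) \<and> bij_betw a (N - D) (R - {q})"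

lemma exists_collapses:
  assumes "D \<subseteq> N" "q \<in> R" "finite N" "finite R" "card (N - D) = card (R - {q})"
  shows "\<exists>a. collapses N R a D q"
proof -
  obtain b where b: "bij_betw b (N - D) (R - {q})"
    using assms by (meson finite_Diff finite_same_card_bij)
  let ?a = "\<lambda>P. if P \<in> D then q else b P"
  have "bij_betw ?a (N - D) (R - {q})"
    using b by (subst bij_betw_cong[where g = b]) simp_all
  then have "collapses N R ?a D q" using assms(1,2) by (simp add: collapses_def)
  then show ?thesis by blast
qed

lemma collapses_eq_iff: "collapses N R a D q \<Longrightarrow> P \<in> N \<Longrightarrow> a P = q \<longleftrightarrow> P \<in> D"
  by (auto simp: collapses_def dest: bij_betwE)

lemma collapses_surj:
  assumes "collapses N R a D q" "D \<noteq> {}"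
  shows "a ` N = R"
proof -
  have "a ` D = {q}" "a ` (N - D) = R - {q}" "N = D \<union> (N - D)" "q \<in> R"
    using assms by (auto simp: collapses_def bij_betw_def)
  then show ?thesis by (metis image_Un insert_Diff insert_is_Un)
qed

lemma collapses_bij_betw:
  assumes "collapses N R a (insert P D) q" "P \<notin> D"
  shows "bij_betw a (N - D) R"
proof -
  have "bij_betw a (insert P (N - insert P D)) (insert (a P) (R - {q}))"
    using assms(1) notIn_Un_bij_betw[of P "N - insert P D" a "R - {q}"] by (auto simp: collapses_def)
  moreover have "insert P (N - insert P D) = N - D" "insert (a P) (R - {q}) = R"
    using assms by (auto simp: collapses_def)
  ultimately show ?thesis by simp
qed

lemma collapses_insert:
  assumes bij: "bij_betw a (N - D) R" and "D \<subseteq> N" and P: "P \<in> N - D"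
  shows "collapses N R (\<lambda>P'. if P' \<in> D then a P else a P') (insert P D) (a P)"
    (is "collapses N R ?a _ _")
proof -
  have "bij_betw a (N - D - {P}) (R - {a P})"
    using bij P by (intro bij_betw_DiffI) (auto dest: bij_betwE)
  moreover have "N - D - {P} = N - insert P D" by auto
  moreover have "bij_betw ?a (N - insert P D) (R - {a P}) \<longleftrightarrow> bij_betw a (N - insert P D) (R - {a P})"
    by (rule bij_betw_cong) simp
  ultimately have "bij_betw ?a (N - insert P D) (R - {a P})" by simp
  then show ?thesis using assms by (auto simp: collapses_def dest: bij_betwE)
qed

text \<open>The bijections \<open>\<beta>\<close> are encoded facetwise: \<open>\<alpha> f\<close> is a total map on colours that restricts to
  \<open>\<beta> e\<close> for every codimension one face \<open>e\<close> of \<open>f\<close>, which forces it to be constantly \<open>\<phi> f\<close> on the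
  colours of \<open>f\<close>.\<close>

definition coupled ::
    "nat \<Rightarrow> 'n set \<Rightarrow> 'r set \<Rightarrow> 'a set set \<Rightarrow> ('a \<Rightarrow> 'n) \<Rightarrow> ('a set \<Rightarrow> 'r) \<Rightarrow> ('a set \<Rightarrow> 'n \<Rightarrow> 'r) \<Rightarrow> bool" where
  "coupled d N R S c \<phi> \<alpha> \<longleftrightarrow>
     (\<forall>f\<in>S. inj_on c f \<and> collapses N R (\<alpha> f) (c ` f) (\<phi> f)) \<and>
     (\<forall>f\<in>S. \<forall>g\<in>S. card (f \<inter> g) = d \<longrightarrow> (\<forall>P\<in>N - c ` (f \<inter> g). \<alpha> f P = \<alpha> g P))"

lemma exists_coupled_singleton:
  assumes "inj_on c f" "c ` f \<subseteq> N" "\<phi> f \<in> R" "card f = Suc d"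
    and "finite N" "finite R" "card N = card R + d"
  shows "\<exists>\<alpha>. coupled d N R {f} c \<phi> \<alpha>"
proof -
  have "card (N - c ` f) = card (R - {\<phi> f})"
    using assms by (simp add: card_Diff_subset card_image finite_subset)
  then obtain a where "collapses N R a (c ` f) (\<phi> f)" using exists_collapses assms by metis
  then have "coupled d N R {f} c \<phi> (\<lambda>_. a)" using assms(1,4) by (simp add: coupled_def)
  then show ?thesis by blast
qed

lemma coupled_insertI:
  assumes cp: "coupled d N R S c \<phi> \<alpha>"
    and f: "inj_on c f" "collapses N R (\<alpha> f) (c ` f) (\<phi> f)" "card f \<noteq> d"
    and agree: "\<And>g P. g \<in> S \<Longrightarrow> card (f \<inter> g) = d \<Longrightarrow> P \<in> N - c ` (f \<inter> g) \<Longrightarrow> \<alpha> f P = \<alpha> g P"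
  shows "coupled d N R (insert f S) c \<phi> \<alpha>"
  unfolding coupled_def
proof (intro conjI ballI impI)
  fix g assume "g \<in> insert f S"
  then show "inj_on c g" "collapses N R (\<alpha> g) (c ` g) (\<phi> g)" using cp f by (auto simp: coupled_def)
next
  fix g h P assume gh: "g \<in> insert f S" "h \<in> insert f S" "card (g \<inter> h) = d" "P \<in> N - c ` (g \<inter> h)"
  then consider (old) "g \<in> S" "h \<in> S" | (left) "g = f" "h \<in> S" | (right) "g \<in> S" "h = f"
    using f(3) by auto
  then show "\<alpha> g P = \<alpha> h P"
  proof cases
    case old
    then show ?thesis using cp gh(3,4) by (simp add: coupled_def)
  next
    case left
    then show ?thesis using agree[of h P] gh(3,4) by simp
  next
    case right
    then show ?thesis using agree[of g P] gh(3,4) by (simp add: Int_commute)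
  qed
qed

lemma coupled_cong:
  assumes "\<And>v. v \<in> \<Union>S \<Longrightarrow> c v = c' v" "\<And>f. f \<in> S \<Longrightarrow> \<phi> f = \<phi>' f" "\<And>f. f \<in> S \<Longrightarrow> \<alpha> f = \<alpha>' f"
  shows "coupled d N R S c \<phi> \<alpha> \<longleftrightarrow> coupled d N R S c' \<phi>' \<alpha>'"
proof -
  have "inj_on c f \<longleftrightarrow> inj_on c' f" "c ` f = c' ` f" "c ` (f \<inter> g) = c' ` (f \<inter> g)" if "f \<in> S" for f g
    using that assms(1) by (auto intro!: inj_on_cong image_cong)
  then show ?thesis using assms(2,3) unfolding coupled_def by (simp cong: ball_cong)
qed

context stacked_complex
begin

lemma coupled_bij_betw:
  assumes cp: "coupled d N R S c \<phi> \<alpha>" and h: "h \<in> S" "S \<subseteq> facets X" and e: "e \<subseteq> h" "card e = d"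
  shows "bij_betw (\<alpha> h) (N - c ` e) R"
proof -
  have "card h = Suc d" using h card_facet by blast
  moreover have "h \<inter> e = e" using e(1) by auto
  ultimately obtain u where u: "h - e = {u}" using Diff_eq_singleton_of_card_Int[of h d e] e(2) by auto
  then have "h = insert u e" "u \<notin> e" using e(1) by auto
  moreover have "inj_on c h" "collapses N R (\<alpha> h) (c ` h) (\<phi> h)"
    using cp h(1) by (auto simp: coupled_def)
  ultimately show ?thesis by (intro collapses_bij_betw[of N R _ "c u"]) auto
qed

lemma coupled_agree:
  assumes cp: "coupled d N R S c \<phi> \<alpha>" and "S \<subseteq> facets X" "g \<in> S" "h \<in> S"
    and e: "e \<subseteq> g" "e \<subseteq> h" "card e = d" and P: "P \<in> N - c ` e"
  shows "\<alpha> g P = \<alpha> h P"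
proof (cases "g = h")
  case False
  then have "g \<inter> h = e"
    using Int_eq_of_card_Suc[OF card_facet card_facet, of g h e] assms(2-4) e by auto
  then show ?thesis using cp \<open>g \<in> S\<close> \<open>h \<in> S\<close> e(3) P by (simp add: coupled_def)
qed simp

lemma coupled_insert:
  assumes cp: "coupled d N R S c \<phi> \<alpha>" and S: "S \<subseteq> facets X" and f: "f \<in> facets X"
    and h: "h \<in> S" and v: "v \<in> f" "v \<notin> \<Union>S" "f - {v} \<subseteq> h"
    and cv: "c v \<in> N - c ` (f - {v})" and \<phi>f: "\<phi> f = \<alpha> h (c v)"
  shows "\<exists>\<alpha>'. coupled d N R (insert f S) c \<phi> \<alpha>'"
proof -
  define e where "e = f - {v}"
  let ?\<alpha> = "\<alpha>(f := \<lambda>P. if P \<in> c ` e then \<alpha> h (c v) else \<alpha> h P)"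
  have e: "f = insert v e" "v \<notin> e" "e \<subseteq> h" "card e = d"
    using v card_facet[OF f] finite_facet[OF f] by (auto simp: e_def)
  have inj_h: "inj_on c h" "c ` h \<subseteq> N" using cp h by (auto simp: coupled_def collapses_def)
  have "f \<notin> S" using v(1,2) by auto
  have "coupled d N R S c \<phi> ?\<alpha>"
    using cp \<open>f \<notin> S\<close> by (subst (asm) coupled_cong[where \<alpha>' = ?\<alpha>]) auto
  moreover have "inj_on c f"
    using inj_on_subset[OF inj_h(1) e(3)] cv unfolding e(1) by (auto simp: e(2))
  moreover have "collapses N R (?\<alpha> f) (c ` f) (\<phi> f)"
  proof -
    have "c ` e \<subseteq> N" using inj_h(2) e(3) by auto
    moreover have "bij_betw (\<alpha> h) (N - c ` e) R" by (rule coupled_bij_betw[OF cp h S e(3,4)])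
    ultimately have "collapses N R (?\<alpha> f) (insert (c v) (c ` e)) (\<alpha> h (c v))"
      using collapses_insert[of "\<alpha> h" N "c ` e" R "c v"] cv by (simp add: e_def)
    moreover have "c ` f = insert (c v) (c ` e)" by (simp add: e(1))
    ultimately show ?thesis by (simp only: \<phi>f)
  qed
  moreover have "card f \<noteq> d" using card_facet[OF f] by simp
  moreover have "?\<alpha> f P = ?\<alpha> g P" if g: "g \<in> S" "card (f \<inter> g) = d" and P: "P \<in> N - c ` (f \<inter> g)" for g P
  proof -
    have "v \<notin> g" "g \<noteq> f" using v(1,2) g(1) by auto
    then have fg: "f \<inter> g = e" using adjacent_Int_eq_Diff[OF f v(1) _ g(2)] by (simp add: e_def)
    have "e \<subseteq> g" using fg by auto
    then have "\<alpha> h P = \<alpha> g P"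
      using P e(3,4) g(1) h fg by (intro coupled_agree[OF cp S, of h g e]) simp_all
    then show ?thesis using P fg \<open>g \<noteq> f\<close> by (simp add: e_def)
  qed
  ultimately have "coupled d N R (insert f S) c \<phi> ?\<alpha>" by (rule coupled_insertI)
  then show ?thesis by blast
qed

lemma exists_coupled_of_colouring:
  assumes proper: "proper (\<in>) c" and cN: "c ` vertices X \<subseteq> N"
    and card: "finite N" "finite R" "card N = card R + d" and "R \<noteq> {}"
  shows "\<exists>\<phi> \<alpha>. coupled d N R (facets X) c \<phi> \<alpha>"
proof -
  have inj: "inj_on c f" if "f \<in> facets X" for f using proper that by (simp add: proper_def)
  show ?thesis
  proof (induction rule: stacking_induct)
    case (base f)
    obtain q where q: "q \<in> R" using \<open>R \<noteq> {}\<close> by blast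
    have "c ` f \<subseteq> N" using base cN unfolding vertices_eq_Union_facets by blast
    then show ?case
      using exists_coupled_singleton[of c f N "\<lambda>_. q" R d] inj[OF base] card_facet[OF base] card q
      by blast
  next
    case (step S f h v)
    then obtain \<phi> \<alpha> where cp: "coupled d N R S c \<phi> \<alpha>" by blast
    let ?\<phi> = "\<phi>(f := \<alpha> h (c v))"
    have "f \<notin> S" using step(4,5) by auto
    then have "coupled d N R S c ?\<phi> \<alpha>"
      using cp by (subst (asm) coupled_cong[where \<phi>' = ?\<phi>]) auto
    moreover have "c v \<in> N - c ` (f - {v})"
    proof
      show "c v \<in> N" using cN step(2,4) unfolding vertices_eq_Union_facets by blast
      show "c v \<notin> c ` (f - {v})" using inj[OF step(2)] step(4) by (auto simp: inj_on_def)
    qed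
    ultimately show ?case using coupled_insert[of N R S c ?\<phi> \<alpha> f h v] step(1-6) by auto
  qed
qed

lemma exists_coupled_of_labelling:
  assumes \<phi>: "\<phi> ` facets X \<subseteq> R" and card: "finite N" "finite R" "card N = card R + d" and "R \<noteq> {}"
  shows "\<exists>c \<alpha>. coupled d N R (facets X) c \<phi> \<alpha>"
proof (induction rule: stacking_induct)
  case (base f)
  have "card R \<noteq> 0" using \<open>R \<noteq> {}\<close> card(2) by simp
  then obtain c where "c ` f \<subseteq> N" "inj_on c f"
    using card_le_inj[OF finite_facet[OF base] card(1)] card(3) card_facet[OF base] by auto
  then show ?case
    using exists_coupled_singleton[of c f N \<phi> R d] base \<phi> card_facet[OF base] card by blast
next
  case (step S f h v)
  then obtain c \<alpha> where cp: "coupled d N R S c \<phi> \<alpha>" by blast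
  have "card (f - {v}) = d" using step(2,4) card_facet finite_facet by simp
  then have "bij_betw (\<alpha> h) (N - c ` (f - {v})) R"
    using coupled_bij_betw[OF cp step(3,1,6)] by blast
  moreover have "\<phi> f \<in> R" using \<phi> step(2) by blast
  ultimately obtain P where P: "P \<in> N - c ` (f - {v})" "\<alpha> h P = \<phi> f"
    by (metis bij_betw_imp_surj_on imageE)
  let ?c = "c(v := P)"
  have "coupled d N R S ?c \<phi> \<alpha>"
    using cp step(5) by (subst (asm) coupled_cong[where c' = ?c]) auto
  moreover have "?c v \<in> N - ?c ` (f - {v})" using P(1) by (auto simp: image_iff)
  ultimately show ?case using coupled_insert[of N R S ?c \<phi> \<alpha> f h v] step(1-6) P(2) by auto
qed

end

locale coupling = stacked_complex +
  fixes N :: "'n set" and R :: "'r set" and c :: "'a \<Rightarrow> 'n" and \<phi> :: "'a set \<Rightarrow> 'r"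
    and \<alpha> :: "'a set \<Rightarrow> 'n \<Rightarrow> 'r"
  assumes coupled: "coupled d N R (facets X) c \<phi> \<alpha>"
begin

lemma inj_on_facet: "f \<in> facets X \<Longrightarrow> inj_on c f"
  and collapses_facet: "f \<in> facets X \<Longrightarrow> collapses N R (\<alpha> f) (c ` f) (\<phi> f)"
  using coupled by (auto simp: coupled_def)

lemma proper_colouring: "proper (\<in>) c"
  by (simp add: proper_def inj_on_facet)

lemma alpha_eq_label_iff: "f \<in> facets X \<Longrightarrow> P \<in> N \<Longrightarrow> \<alpha> f P = \<phi> f \<longleftrightarrow> P \<in> c ` f"
  using collapses_facet by (rule collapses_eq_iff)

lemma alpha_image: "f \<in> facets X \<Longrightarrow> \<alpha> f ` N = R"
  using collapses_surj[OF collapses_facet] card_facet by fastforce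

lemma alpha_adjacent:
  "f \<in> facets X \<Longrightarrow> g \<in> facets X \<Longrightarrow> card (f \<inter> g) = d \<Longrightarrow> P \<in> N \<Longrightarrow> P \<notin> c ` (f \<inter> g) \<Longrightarrow> \<alpha> f P = \<alpha> g P"
  using coupled by (auto simp: coupled_def)

lemma alpha_walk:
  assumes "walk X d (f # fs)" "P \<in> N" "fs \<noteq> [] \<Longrightarrow> P \<notin> c ` (f \<inter> hd fs)"
    and "\<forall>h\<in>set (butlast fs). P \<in> c ` h \<longrightarrow> \<phi> h \<noteq> \<alpha> f P"
  shows "\<forall>h\<in>set fs. \<alpha> h P = \<alpha> f P"
  using assms
proof (induction fs arbitrary: f)
  case (Cons g fs)
  have g: "f \<in> facets X" "g \<in> facets X" "card (f \<inter> g) = d" "walk X d (g # fs)"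
    using Cons.prems(1) by (auto simp: walk_Cons_Cons walk_iff_successively)
  then have fg: "\<alpha> f P = \<alpha> g P" using Cons.prems(2,3) by (intro alpha_adjacent) simp_all
  have "P \<notin> c ` g" if "fs \<noteq> []"
    using Cons.prems(2,4) that fg alpha_eq_label_iff[OF g(2) Cons.prems(2)] by auto
  then have "\<forall>h\<in>set fs. \<alpha> h P = \<alpha> g P"
    using Cons.prems(2,4) g(4) fg by (intro Cons.IH) (auto split: if_splits)
  then show ?case using fg by simp
qed simp

text \<open>The left-hand side is the condition in the definition of \<open>\<Phi>\<close>, the right-hand side the one
  in the definition of \<open>\<Psi>\<close>.\<close>

lemma walk_ends_iff:
  assumes w: "walk X d (f # gs @ [g])"
    and v: "v \<in> f" "v \<notin> hd (gs @ [g])" and u: "u \<in> g" "u \<notin> last (f # gs)"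
  shows "c v = c u \<and> (\<forall>h\<in>set gs. c v \<notin> c ` h) \<longleftrightarrow> \<phi> f = \<phi> g \<and> (\<forall>h\<in>set gs. \<phi> h \<noteq> \<phi> f)"
    (is "?colours \<longleftrightarrow> ?labels")
proof -
  have facets: "f \<in> facets X" "g \<in> facets X" "h \<in> set gs \<Longrightarrow> h \<in> facets X" for h
    using w by (auto simp: walk_iff_successively)
  have cv: "c v \<in> N" "\<alpha> f (c v) = \<phi> f"
    using collapses_facet[OF facets(1)] v(1) by (auto simp: collapses_def)
  have start: "c v \<notin> c ` (f \<inter> hd (gs @ [g]))"
    using inj_on_facet[OF facets(1)] v by (auto simp: inj_on_def)
  have along: "\<alpha> g (c v) = \<phi> f \<and> (\<forall>h\<in>set gs. \<alpha> h (c v) = \<phi> f)"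
    if "\<forall>h\<in>set gs. c v \<in> c ` h \<longrightarrow> \<phi> h \<noteq> \<phi> f"
    using alpha_walk[OF w cv(1)] start that cv(2) by simp
  show ?thesis
  proof
    assume ?colours
    then show ?labels using along facets cv(1) u(1) alpha_eq_label_iff by (metis imageI)
  next
    assume labels: ?labels
    then have const: "\<alpha> g (c v) = \<phi> g" "\<forall>h\<in>set gs. \<alpha> h (c v) = \<phi> f" using along by auto
    then have inner: "\<forall>h\<in>set gs. c v \<notin> c ` h"
      using labels facets(3) cv(1) alpha_eq_label_iff by metis
    obtain x where x: "x \<in> g" "c x = c v"
      using const(1) alpha_eq_label_iff[OF facets(2) cv(1)] by auto
    have "x \<notin> last (f # gs)"
    proof (cases "gs = []")
      case True
      then show ?thesis using start x by (metis IntI append_Nil image_eqI last_ConsL list.sel(1))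
    next
      case False
      then show ?thesis using inner x by (metis image_eqI last_ConsR last_in_set)
    qed
    then have "x = u" using walk_ends_Diff[OF w] x(1) u by (metis DiffI singletonD)
    then show ?colours using x(2) inner by simp
  qed
qed

lemma colour_used_iff_label_used:
  assumes f: "f \<in> facets X" and P: "P \<in> N"
  shows "P \<in> c ` vertices X \<longleftrightarrow> \<alpha> f P \<in> \<phi> ` facets X"
proof (rule ccontr)
  assume differ: "\<not> ?thesis"
  have avoid: "\<phi> g \<noteq> \<alpha> f P" if g: "g \<in> facets X" "P \<in> c ` g" for g
  proof
    assume "\<phi> g = \<alpha> f P"
    then have "\<alpha> f P \<in> \<phi> ` facets X" using g(1) by (metis imageI)
    moreover have "P \<in> c ` vertices X" using g unfolding vertices_eq_Union_facets by blast
    ultimately show False using differ by blast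
  qed
  have "\<alpha> g P = \<alpha> f P" if g: "g \<in> facets X" for g
  proof -
    obtain fs where fs: "walk X d fs" "hd fs = f" "last fs = g" using exists_walk f g by blast
    then obtain gs where gs: "fs = f # gs" by (cases fs) (auto simp: walk_iff_successively)
    have facets: "set gs \<subseteq> facets X" using fs(1) by (simp add: gs walk_iff_successively)
    have "P \<notin> c ` f" using avoid[OF f] alpha_eq_label_iff[OF f P] by auto
    then have "\<forall>h\<in>set gs. \<alpha> h P = \<alpha> f P"
      using fs(1) P avoid facets unfolding gs by (intro alpha_walk) (auto dest: in_set_butlastD)
    then show ?thesis using fs(3) by (cases "gs = []") (auto simp: gs)
  qed
  then have "P \<notin> c ` g" "\<phi> g \<noteq> \<alpha> f P" if "g \<in> facets X" for g
    using that avoid alpha_eq_label_iff[OF that P] by metis+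
  then have "P \<notin> c ` vertices X" "\<alpha> f P \<notin> \<phi> ` facets X"
    unfolding vertices_eq_Union_facets image_iff by (blast, metis)
  then show False using differ by blast
qed

lemma colours_surj_iff_labels_surj: "c ` vertices X = N \<longleftrightarrow> \<phi> ` facets X = R"
proof -
  obtain f where f: "f \<in> facets X" using facets_nonempty by blast
  have "c ` vertices X \<subseteq> N"
    using collapses_facet unfolding vertices_eq_Union_facets collapses_def by blast
  then have "c ` vertices X = N \<longleftrightarrow> (\<forall>P\<in>N. P \<in> c ` vertices X)" by blast
  also have "\<dots> \<longleftrightarrow> \<alpha> f ` N \<subseteq> \<phi> ` facets X"
    using colour_used_iff_label_used[OF f] by (simp add: image_subset_iff)
  also have "\<dots> \<longleftrightarrow> \<phi> ` facets X = R"
    using collapses_facet unfolding alpha_image[OF f] collapses_def by blast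
  finally show ?thesis .
qed

lemma label_link_iff_colour_link:
  assumes path: "is_path X d (f # gs @ [g])"
    and v: "v \<in> f" "v \<notin> hd (gs @ [g])" and w: "w \<in> g" "w \<notin> last (f # gs)"
  shows "link (=) \<phi> (f # gs @ [g]) f g \<longleftrightarrow> link (\<in>) c (f # gs @ [g]) v w"
proof -
  have "v \<noteq> w" using path_left_vertex_notin_last[OF path v] w(1) by blast
  then have colour: "link (\<in>) c (f # gs @ [g]) v w \<longleftrightarrow> c v = c w \<and> (\<forall>h\<in>set gs. c v \<notin> c ` h)"
    using path v w unfolding link_mem_iff list.inject append1_eq_conv by metis
  have "f \<noteq> g" using path_left_vertex_notin_last[OF path v] v(1) by blast
  then have label: "link (=) \<phi> (f # gs @ [g]) f g \<longleftrightarrow> \<phi> f = \<phi> g \<and> (\<forall>h\<in>set gs. \<phi> h \<noteq> \<phi> f)"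
    using path by (simp add: link_eq_iff)
  have "walk X d (f # gs @ [g])" using path by (simp add: is_path_iff_ridges)
  then show ?thesis unfolding colour label using v w by (rule walk_ends_iff[symmetric])
qed

lemma PhiRel_fibres:
  "PhiRel X d (fibres c (vertices X)) = {(f, g). \<exists>fs. link (=) \<phi> fs f g}"
proof -
  have ends_iff: "(\<exists>v w. f - hd (gs @ [g]) = {v} \<and> g - last (f # gs) = {w} \<and>
      (\<exists>P\<in>fibres c (vertices X). v \<in> P \<and> w \<in> P \<and> (\<forall>h\<in>set gs. h \<inter> P = {}))) \<longleftrightarrow>
    \<phi> f = \<phi> g \<and> (\<forall>h\<in>set gs. \<phi> h \<noteq> \<phi> f)" (is "?colours \<longleftrightarrow> ?labels")
    if path: "is_path X d (f # gs @ [g])" for f g gs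
  proof -
    have w: "walk X d (f # gs @ [g])" using path by (simp add: is_path_iff_ridges)
    obtain v u where vu: "f - hd (gs @ [g]) = {v}" "g - last (f # gs) = {u}"
      using walk_ends_Diff[OF w] by blast
    then have ends: "v \<in> f" "v \<notin> hd (gs @ [g])" "u \<in> g" "u \<notin> last (f # gs)" by blast+
    have "?colours \<longleftrightarrow> c v = c u \<and> (\<forall>h\<in>set gs. c v \<notin> c ` h)"
      using bex_vertex_fibres_iff[OF w ends(1,3)] by (simp add: vu del: last.simps)
    also have "\<dots> \<longleftrightarrow> ?labels" using w ends by (rule walk_ends_iff)
    finally show ?thesis .
  qed
  have "(f, g) \<in> PhiRel X d (fibres c (vertices X)) \<longleftrightarrow> (\<exists>fs. link (=) \<phi> fs f g)" for f g
  proof -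
    have "(f, g) \<in> PhiRel X d (fibres c (vertices X)) \<longleftrightarrow> f \<noteq> g \<and>
        (\<exists>gs. is_path X d (f # gs @ [g]) \<and> \<phi> f = \<phi> g \<and> (\<forall>h\<in>set gs. \<phi> h \<noteq> \<phi> f))"
      unfolding PhiRel_iff by (intro conj_cong ex_cong1 refl ends_iff)
    also have "\<dots> \<longleftrightarrow> (\<exists>fs. link (=) \<phi> fs f g)" unfolding link_eq_iff by blast
    finally show ?thesis .
  qed
  then show ?thesis by auto
qed

lemma PsiRel_fibres:
  "PsiRel X d (fibres \<phi> (facets X)) = {(v, w). \<exists>fs. link (\<in>) c fs v w}"
proof (intro set_eqI iffI; clarify)
  fix v w assume "(v, w) \<in> PsiRel X d (fibres \<phi> (facets X))"
  then obtain f gs g where "v \<noteq> w" and path: "is_path X d (f # gs @ [g])"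
    and ends: "v \<in> f" "v \<notin> hd (gs @ [g])" "w \<in> g" "w \<notin> last (f # gs)"
    and Q: "\<exists>Q\<in>fibres \<phi> (facets X). f \<in> Q \<and> g \<in> Q \<and> (\<forall>h\<in>set gs. h \<notin> Q)"
    unfolding PsiRel_iff by blast
  have walk: "walk X d (f # gs @ [g])" using path by (simp add: is_path_iff_ridges)
  have "c v = c w \<and> (\<forall>h\<in>set gs. c v \<notin> c ` h)"
    using Q unfolding bex_facet_fibres_iff[OF walk] walk_ends_iff[OF walk ends] .
  then show "\<exists>fs. link (\<in>) c fs v w" using path ends \<open>v \<noteq> w\<close> unfolding link_mem_iff by blast
next
  fix v w fs assume "link (\<in>) c fs v w"
  then obtain f gs g where vw: "v \<noteq> w" "c v = c w" and path: "is_path X d (f # gs @ [g])"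
    and ends: "v \<in> f" "v \<notin> hd (gs @ [g])" "w \<in> g" "w \<notin> last (f # gs)"
    and inner: "\<forall>h\<in>set gs. c v \<notin> c ` h"
    unfolding link_mem_iff by blast
  have walk: "walk X d (f # gs @ [g])" using path by (simp add: is_path_iff_ridges)
  have "\<exists>Q\<in>fibres \<phi> (facets X). f \<in> Q \<and> g \<in> Q \<and> (\<forall>h\<in>set gs. h \<notin> Q)"
    using vw(2) inner
    unfolding bex_facet_fibres_iff[OF walk] walk_ends_iff[OF walk ends, symmetric] by blast
  moreover have "\<not> (\<exists>f\<in>facets X. v \<in> f \<and> w \<in> f)" using inj_on_facet vw by (meson inj_onD)
  moreover have "f \<in> facets X" "g \<in> facets X" using walk by (simp_all add: walk_iff_successively)
  then have "v \<in> vertices X" "w \<in> vertices X" using ends unfolding vertices_eq_Union_facets by blast+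
  ultimately show "(v, w) \<in> PsiRel X d (fibres \<phi> (facets X))"
    unfolding PsiRel_iff using vw(1) path ends by blast
qed

lemma Phi_fibres: "Phi X d (fibres c (vertices X)) = fibres \<phi> (facets X)"
  unfolding Phi_def using PhiRel_fibres proper_eq by (intro quotient_links) auto

lemma Psi_fibres: "Psi X d (fibres \<phi> (facets X)) = fibres c (vertices X)"
  unfolding Psi_def using PsiRel_fibres proper_colouring
  by (intro quotient_links) (auto simp: vertices_eq_Union_facets)

lemma exists_colour_link_iff: "(\<exists>v w. link (\<in>) c fs v w) \<longleftrightarrow> (\<exists>f g. link (=) \<phi> fs f g)"
proof (intro iffI; elim exE)
  fix v w assume link: "link (\<in>) c fs v w"
  then obtain f gs g where fs: "fs = f # gs @ [g]" "is_path X d (f # gs @ [g])"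
    "v \<in> f" "v \<notin> hd (gs @ [g])" "w \<in> g" "w \<notin> last (f # gs)"
    unfolding link_mem_iff by blast
  then show "\<exists>f g. link (=) \<phi> fs f g" using link label_link_iff_colour_link[OF fs(2-6)] by blast
next
  fix f g assume link: "link (=) \<phi> fs f g"
  then obtain gs where fs: "fs = f # gs @ [g]" "is_path X d (f # gs @ [g])"
    unfolding link_eq_iff by blast
  then obtain v w where "f - hd (gs @ [g]) = {v}" "g - last (f # gs) = {w}"
    using walk_ends_Diff[of f gs g] by (auto simp: is_path_iff_ridges)
  then have "v \<in> f" "v \<notin> hd (gs @ [g])" "w \<in> g" "w \<notin> last (f # gs)" by blast+
  then show "\<exists>v w. link (\<in>) c fs v w" using link label_link_iff_colour_link[OF fs(2)] fs(1) by blast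
qed

lemma separated_colours_iff_labels: "separated (\<in>) c n \<longleftrightarrow> separated (=) \<phi> n"
proof -
  have "separated (\<in>) c n \<longleftrightarrow> (\<forall>fs v w. link (\<in>) c fs v w \<longrightarrow> n \<le> length fs)"
    using proper_colouring by (rule separated_iff_link)
  also have "\<dots> \<longleftrightarrow> (\<forall>fs f g. link (=) \<phi> fs f g \<longrightarrow> n \<le> length fs)"
    using exists_colour_link_iff by meson
  also have "\<dots> \<longleftrightarrow> separated (=) \<phi> n"
    using proper_eq by (rule separated_iff_link[symmetric])
  finally show ?thesis .
qed

lemma fibres_scattered_partitions_iff:
  assumes "card N = card R + d" "c ` vertices X = N"
  shows "fibres c (vertices X) \<in> scattered_vertex_partitions (r + d) (s + 1) \<longleftrightarrow>
    fibres \<phi> (facets X) \<in> scattered_facet_partitions r s"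
proof -
  have "card (fibres c (vertices X)) = card (fibres \<phi> (facets X)) + d"
    using assms colours_surj_iff_labels_surj by (simp add: card_fibres)
  then show ?thesis
    using separated_colours_iff_labels
    by (simp add: scattered_vertex_partitions_def scattered_facet_partitions_def partition_on_fibres
        vertex_scattered_fibres_iff facet_scattered_fibres_iff)
qed

end

context stacked_complex
begin

lemma Phi_scattered_partition:
  assumes VV: "VV \<in> scattered_vertex_partitions (r + d) (s + 1)" and r: "1 \<le> r" and s: "1 \<le> s"
  shows "Phi X d VV \<in> scattered_facet_partitions r s \<and> Psi X d (Phi X d VV) = VV"
proof -
  have part: "partition_on (vertices X) VV" and card: "card VV = r + d"
    and scattered: "\<forall>P\<in>VV. vertex_scattered X d (s + 1) P"
    using VV by (auto simp: scattered_vertex_partitions_def)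
  obtain c where c: "c ` vertices X = VV" "fibres c (vertices X) = VV"
    using part by (rule partition_on_eq_fibres)
  have "separated (\<in>) c (s + 1)" using scattered c(2) by (simp flip: vertex_scattered_fibres_iff)
  then have "proper (\<in>) c" by (rule separated_imp_proper) (use s in simp)
  moreover have "finite VV" using card r by (intro card_ge_0_finite) simp
  moreover have "{..<r} \<noteq> {}" using r by (simp add: lessThan_empty_iff)
  ultimately obtain \<phi> \<alpha> where "coupled d VV {..<r} (facets X) c \<phi> \<alpha>"
    using exists_coupled_of_colouring[of c VV "{..<r}"] c(1) card by auto
  then interpret coupling X d VV "{..<r}" c \<phi> \<alpha> by unfold_locales
  show ?thesis
    using fibres_scattered_partitions_iff Phi_fibres Psi_fibres VV c card by simp
qed

lemma Psi_scattered_partition: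
  assumes FF: "FF \<in> scattered_facet_partitions r s" and r: "1 \<le> r"
  shows "Psi X d FF \<in> scattered_vertex_partitions (r + d) (s + 1) \<and> Phi X d (Psi X d FF) = FF"
proof -
  have part: "partition_on (facets X) FF" and card: "card FF = r"
    using FF by (auto simp: scattered_facet_partitions_def)
  obtain \<phi> where \<phi>: "\<phi> ` facets X = FF" "fibres \<phi> (facets X) = FF"
    using part by (rule partition_on_eq_fibres)
  have "finite FF" "FF \<noteq> {}" using card r by (auto intro: card_ge_0_finite)
  then obtain c \<alpha> where "coupled d {..<r + d} FF (facets X) c \<phi> \<alpha>"
    using exists_coupled_of_labelling[of \<phi> FF "{..<r + d}"] \<phi>(1) card by auto
  then interpret coupling X d "{..<r + d}" FF c \<phi> \<alpha> by unfold_locales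
  show ?thesis
    using fibres_scattered_partitions_iff colours_surj_iff_labels_surj Phi_fibres Psi_fibres FF \<phi> card
    by simp
qed

end

theorem theorem3p6:
  fixes X :: "'a set set" and d r s :: nat
  assumes "stacked X d" and "1 \<le> r" and "1 \<le> s"
  defines "A \<equiv> {VV. partition_on (vertices X) VV \<and> card VV = r + d \<and>
                     (\<forall>P\<in>VV. vertex_scattered X d (s + 1) P)}"
      and "B \<equiv> {FF. partition_on (facets X) FF \<and> card FF = r \<and>
                     (\<forall>Q\<in>FF. facet_scattered X d s Q)}"
  shows "bij_betw (Phi X d) A B \<and> bij_betw (Psi X d) B A \<and>
         (\<forall>VV\<in>A. Psi X d (Phi X d VV) = VV) \<and> (\<forall>FF\<in>B. Phi X d (Psi X d FF) = FF)"
proof -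
  interpret stacked_complex X d by unfold_locales (rule assms(1))
  have A: "A = scattered_vertex_partitions (r + d) (s + 1)" and B: "B = scattered_facet_partitions r s"
    by (simp_all add: A_def B_def scattered_vertex_partitions_def scattered_facet_partitions_def)
  have Phi: "\<forall>VV\<in>A. Phi X d VV \<in> B \<and> Psi X d (Phi X d VV) = VV"
    using Phi_scattered_partition assms(2,3) unfolding A B by blast
  have Psi: "\<forall>FF\<in>B. Psi X d FF \<in> A \<and> Phi X d (Psi X d FF) = FF"
    using Psi_scattered_partition assms(2) unfolding A B by blast
  have "bij_betw (Phi X d) A B"
    by (rule bij_betw_byWitness[where f' = "Psi X d"]) (use Phi Psi in auto)
  moreover have "bij_betw (Psi X d) B A"
    by (rule bij_betw_byWitness[where f' = "Phi X d"]) (use Phi Psi in auto)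
  ultimately show ?thesis using Phi Psi by blast
qed

end
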